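(* Let $R$ be a commutative ring with $1\neq 0$, let $\tau$ be a symmetric relation on $R^{\#}$, and let $\tau_{\mathrm{reg}}:=\tau\cap(\mathrm{Reg}(R)\times\mathrm{Reg}(R))$. Let $\alpha\in\{\emptyset$, atomic, strongly atomic, m-atomic, unrefinably atomic, very strongly atomic$\}$. Then every non-unit factor in a $\tau_{\mathrm{reg}}$-U-$\alpha$-factorization is an essential divisor (that is, there are no inessential divisors). Moreover, given a $\tau_{\mathrm{reg}}$-$\alpha$-factorization $a=\lambda a_1\cdots a_n$ of a non-unit $a\in R$, every factor is essential, i.e. $a_j(a_1\cdots\widehat{a_j}\cdots a_n)\ne(a_1\cdots\widehat{a_j}\cdots a_n)$ for all $1\le j\le n$.
   Context: $U(R)$ is the group of units of $R$, $R^{\#}$ the set of nonzero non-units, $\mathrm{Reg}(R)$ the set of regular elements (non-zero-divisors). $a\sim b$ means $(a)=(b)$; $a\approx b$ means $a=\lambda b$ for some $\lambda\in U(R)$; $a\cong b$ means $a\sim b$ and either $a=b=0$ or, whenever $a=rb$ with $r\in R$, one has $r\in U(R)$. Empty products equal $1$, $(x)$ is the principal ideal generated by $x$, and $\widehat{x}$ means that $x$ is omitted. Let $\sigma$ be a symmetric relation on $R^{\#}$ (applied with $\sigma=\tau_{\mathrm{reg}}$). A $\sigma$-factorization of a non-unit $a$ is an expression $a=\lambda a_1\cdots a_n$, $n\ge1$, $\lambda\in U(R)$, each $a_i$ a non-unit, $a_i\,\sigma\,a_j$ for all $i\ne j$; it is trivial if $n=1$. A non-unit $a$ is $\sigma$-atomic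 (resp. $\sigma$-strongly atomic, $\sigma$-m-atomic) if for every $\sigma$-factorization $a=\lambda a_1\cdots a_n$ one has $a\sim a_i$ for some $i$ (resp. $a\approx a_i$ for some $i$, $a\sim a_i$ for all $i$); $\sigma$-unrefinably atomic if it has only trivial $\sigma$-factorizations; $\sigma$-very strongly atomic if $a\cong a$ and $a$ has no non-trivial $\sigma$-factorizations. A $\sigma$-$\alpha$-factorization is a $\sigma$-factorization all of whose factors are $\sigma$-$\alpha$. A U-factorization of a non-unit $a$ is a factorization $a=\lambda a_1\cdots a_nb_1\cdots b_m$ with $\lambda\in U(R)$ and all $a_i,b_j$ non-units, written $a=\lambda a_1\cdots a_n\lceil b_1\cdots b_m\rceil$, such that (i) $a_i(b_1\cdots b_m)=(b_1\cdots b_m)$ for $1\le i\le n$ and (ii) $b_j(b_1\cdots\widehat{b_j}\cdots b_m)\ne(b_1\cdots\widehat{b_j}\cdots b_m)$ for $1\le j\le m$. The $b_j$ are the essential divisors and the $a_i$ the inessential divisors. It is a $\sigma$-U-factorization if $\lambda a_1\cdots a_nb_1\cdots b_m$ is also a $\sigma$-factorization, and a $\sigma$-U-$\alpha$-factorization if moreover each $b_j$ is $\sigma$-$\alpha$. When $\alpha=\emptyset$, a $\sigma$-U-$\alpha$-factorization (resp. $\sigma$-$\alpha$-factorization) means simply a $\sigma$-U-factorization (resp. $\sigma$-factorization). *)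

theory Defs
  imports Main
begin

text \<open>The ring R is a type of class \<open>comm_ring_1\<close> (which includes 1 \<noteq> 0). The library's
  \<open>is_unit\<close> is confined to integral domains, whereas R may have zero divisors.\<close>

definition ring_units :: "'a::comm_ring_1 set" where
  "ring_units = {u. u dvd 1}"

definition nonzero_nonunits :: "'a::comm_ring_1 set" where
  "nonzero_nonunits = {x. x \<noteq> 0 \<and> x \<notin> ring_units}"

definition regular_elements :: "'a::comm_ring_1 set" where
  "regular_elements = {x. \<forall>y. x * y = 0 \<longrightarrow> y = 0}"

definition principal_ideal :: "'a::comm_ring_1 \<Rightarrow> 'a set" where
  "principal_ideal x = {r * x | r. True}"

definition ideal_mult :: "'a::comm_ring_1 \<Rightarrow> 'a set \<Rightarrow> 'a set" where
  "ideal_mult a I = {a * x | x. x \<in> I}"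

definition assoc :: "'a::comm_ring_1 \<Rightarrow> 'a \<Rightarrow> bool" where
  "assoc a b \<longleftrightarrow> principal_ideal a = principal_ideal b"

definition strong_assoc :: "'a::comm_ring_1 \<Rightarrow> 'a \<Rightarrow> bool" where
  "strong_assoc a b \<longleftrightarrow> (\<exists>u. u \<in> ring_units \<and> a = u * b)"

definition very_strong_assoc :: "'a::comm_ring_1 \<Rightarrow> 'a \<Rightarrow> bool" where
  "very_strong_assoc a b \<longleftrightarrow>
     assoc a b \<and> ((a = 0 \<and> b = 0) \<or> (\<forall>r. a = r * b \<longrightarrow> r \<in> ring_units))"

definition reg_part :: "('a::comm_ring_1 \<times> 'a) set \<Rightarrow> ('a \<times> 'a) set" where
  "reg_part \<tau> = \<tau> \<inter> (regular_elements \<times> regular_elements)"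

text \<open>A factorization is recorded as its unit \<open>u\<close> together with the list of its non-unit factors.
  The relation is required between factors at distinct positions, so a repeated factor must be
  related to itself.\<close>

definition factorization ::
    "('a::comm_ring_1 \<times> 'a) set \<Rightarrow> 'a \<Rightarrow> 'a \<Rightarrow> 'a list \<Rightarrow> bool" where
  "factorization \<sigma> a u xs \<longleftrightarrow>
     a \<notin> ring_units \<and> u \<in> ring_units \<and> length xs \<ge> 1 \<and> (\<forall>x\<in>set xs. x \<notin> ring_units) \<and>
     (\<forall>i<length xs. \<forall>j<length xs. i \<noteq> j \<longrightarrow> (xs ! i, xs ! j) \<in> \<sigma>) \<and>
     a = u * prod_list xs"

definition atomic :: "('a::comm_ring_1 \<times> 'a) set \<Rightarrow> 'a \<Rightarrow> bool" where
  "atomic \<sigma> a \<longleftrightarrow> a \<notin> ring_units \<and>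
     (\<forall>u xs. factorization \<sigma> a u xs \<longrightarrow> (\<exists>x\<in>set xs. assoc a x))"

definition strongly_atomic :: "('a::comm_ring_1 \<times> 'a) set \<Rightarrow> 'a \<Rightarrow> bool" where
  "strongly_atomic \<sigma> a \<longleftrightarrow> a \<notin> ring_units \<and>
     (\<forall>u xs. factorization \<sigma> a u xs \<longrightarrow> (\<exists>x\<in>set xs. strong_assoc a x))"

definition m_atomic :: "('a::comm_ring_1 \<times> 'a) set \<Rightarrow> 'a \<Rightarrow> bool" where
  "m_atomic \<sigma> a \<longleftrightarrow> a \<notin> ring_units \<and>
     (\<forall>u xs. factorization \<sigma> a u xs \<longrightarrow> (\<forall>x\<in>set xs. assoc a x))"

definition unrefinably_atomic :: "('a::comm_ring_1 \<times> 'a) set \<Rightarrow> 'a \<Rightarrow> bool" where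
  "unrefinably_atomic \<sigma> a \<longleftrightarrow> a \<notin> ring_units \<and>
     (\<forall>u xs. factorization \<sigma> a u xs \<longrightarrow> length xs = 1)"

definition very_strongly_atomic :: "('a::comm_ring_1 \<times> 'a) set \<Rightarrow> 'a \<Rightarrow> bool" where
  "very_strongly_atomic \<sigma> a \<longleftrightarrow> a \<notin> ring_units \<and> very_strong_assoc a a \<and>
     (\<forall>u xs. factorization \<sigma> a u xs \<longrightarrow> length xs = 1)"

datatype atomicity =
  Unrestricted | Atomic | Strongly_Atomic | M_Atomic | Unrefinably_Atomic | Very_Strongly_Atomic

text \<open>\<open>Unrestricted\<close> is the case \<alpha> = \<emptyset>: it imposes no condition on a factor.\<close>

fun has_atomicity :: "atomicity \<Rightarrow> ('a::comm_ring_1 \<times> 'a) set \<Rightarrow> 'a \<Rightarrow> bool" where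
  "has_atomicity Unrestricted \<sigma> a = True"
| "has_atomicity Atomic \<sigma> a = atomic \<sigma> a"
| "has_atomicity Strongly_Atomic \<sigma> a = strongly_atomic \<sigma> a"
| "has_atomicity M_Atomic \<sigma> a = m_atomic \<sigma> a"
| "has_atomicity Unrefinably_Atomic \<sigma> a = unrefinably_atomic \<sigma> a"
| "has_atomicity Very_Strongly_Atomic \<sigma> a = very_strongly_atomic \<sigma> a"

definition alpha_factorization ::
    "atomicity \<Rightarrow> ('a::comm_ring_1 \<times> 'a) set \<Rightarrow> 'a \<Rightarrow> 'a \<Rightarrow> 'a list \<Rightarrow> bool" where
  "alpha_factorization \<alpha> \<sigma> a u xs \<longleftrightarrow>
     factorization \<sigma> a u xs \<and> (\<forall>x\<in>set xs. has_atomicity \<alpha> \<sigma> x)"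

definition omit :: "nat \<Rightarrow> 'a list \<Rightarrow> 'a list" where
  "omit j xs = take j xs @ drop (Suc j) xs"

definition essential_at :: "'a::comm_ring_1 list \<Rightarrow> nat \<Rightarrow> bool" where
  "essential_at xs j \<longleftrightarrow>
     ideal_mult (xs ! j) (principal_ideal (prod_list (omit j xs)))
       \<noteq> principal_ideal (prod_list (omit j xs))"

text \<open>In a U-factorization the list \<open>xs\<close> holds the inessential divisors and \<open>bs\<close> the essential
  ones; either list may be empty.\<close>

definition U_factorization ::
    "'a::comm_ring_1 \<Rightarrow> 'a \<Rightarrow> 'a list \<Rightarrow> 'a list \<Rightarrow> bool" where
  "U_factorization a u xs bs \<longleftrightarrow>
     a \<notin> ring_units \<and> u \<in> ring_units \<and> (\<forall>x\<in>set xs. x \<notin> ring_units) \<and> (\<forall>b\<in>set bs. b \<notin> ring_units) \<and>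
     a = u * prod_list xs * prod_list bs \<and>
     (\<forall>x\<in>set xs. ideal_mult x (principal_ideal (prod_list bs)) = principal_ideal (prod_list bs)) \<and>
     (\<forall>j<length bs. essential_at bs j)"

definition U_alpha_factorization ::
    "atomicity \<Rightarrow> ('a::comm_ring_1 \<times> 'a) set \<Rightarrow> 'a \<Rightarrow> 'a \<Rightarrow> 'a list \<Rightarrow> 'a list \<Rightarrow> bool" where
  "U_alpha_factorization \<alpha> \<sigma> a u xs bs \<longleftrightarrow>
     U_factorization a u xs bs \<and> factorization \<sigma> a u (xs @ bs) \<and>
     (\<forall>b\<in>set bs. has_atomicity \<alpha> \<sigma> b)"

end

theory Submission
  imports Defs
begin

text \<open>An element \<open>x\<close> with \<open>x(p) = (p)\<close> satisfies \<open>p = x r p\<close> for some \<open>r\<close>; if \<open>p\<close> is regular,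
  cancelling it gives \<open>1 = x r\<close>. So a non-unit is never absorbed by a regular principal ideal
  (\<open>not_absorbed_by_regular\<close>), and only the regularity of the products in question is at issue. As
  soon as a factorization with respect to \<open>\<tau>\<^sub>r\<^sub>e\<^sub>g\<close> has two factors, each of them is related to
  another one and hence regular. A single factor need not be regular, but what remains
  when it is omitted is the empty product \<open>1\<close>. Both situations are covered by the fact that all
  factors other than a chosen one are regular (\<open>other_factors_regular\<close>).\<close>

lemma regular_prod_list:
  assumes "set xs \<subseteq> regular_elements"
  shows "prod_list xs \<in> regular_elements"
  using assms
proof (induction xs)
  case Nil
  then show ?case by (simp add: regular_elements_def)
next
  case (Cons x xs)
  then have "x \<in> regular_elements" and "prod_list xs \<in> regular_elements"
    by auto
  then have x: "\<And>y. x * y = 0 \<Longrightarrow> y = 0" and p: "\<And>y. prod_list xs * y = 0 \<Longrightarrow> y = 0"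
    unfolding regular_elements_def by blast+
  show ?case
    unfolding regular_elements_def
  proof (intro CollectI allI impI)
    fix y assume "prod_list (x # xs) * y = 0"
    then have "x * (prod_list xs * y) = 0"
      by (simp add: mult.assoc)
    then show "y = 0"
      by (rule p[OF x])
  qed
qed

lemma not_absorbed_by_regular:
  assumes "x \<notin> ring_units" and "p \<in> regular_elements"
  shows "ideal_mult x (principal_ideal p) \<noteq> principal_ideal p"
proof
  assume eq: "ideal_mult x (principal_ideal p) = principal_ideal p"
  have "p \<in> principal_ideal p"
    unfolding principal_ideal_def by (metis (mono_tags) mem_Collect_eq mult_1_left)
  then have "p \<in> ideal_mult x (principal_ideal p)"
    by (simp add: eq)
  then obtain q where q: "p = x * q" "q \<in> principal_ideal p"
    unfolding ideal_mult_def by blast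
  from q(2) obtain r where "q = r * p"
    unfolding principal_ideal_def by blast
  with q(1) have "p = x * (r * p)"
    by metis
  then have "p * (1 - x * r) = 0"
    by (simp add: algebra_simps)
  with assms(2) have "1 - x * r = 0"
    unfolding regular_elements_def by blast
  then have "1 = x * r"
    by simp
  then have "x \<in> ring_units"
    by (auto simp: ring_units_def dvd_def)
  with assms(1) show False ..
qed

lemma in_set_omitE:
  assumes "y \<in> set (omit j xs)" and "j < length xs"
  obtains k where "k < length xs" "k \<noteq> j" "y = xs ! k"
proof -
  consider "y \<in> set (take j xs)" | "y \<in> set (drop (Suc j) xs)"
    using assms(1) by (auto simp: omit_def)
  then show thesis
  proof cases
    case 1
    then obtain k where "k < j" "y = xs ! k"
      using assms(2) by (auto simp: in_set_conv_nth)
    with assms(2) show ?thesis by (intro that[of k]) auto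
  next
    case 2
    then obtain k where "k < length xs - Suc j" "y = xs ! (Suc j + k)"
      by (auto simp: in_set_conv_nth)
    then show ?thesis by (intro that[of "Suc j + k"]) auto
  qed
qed

text \<open>Each remaining factor is related to the omitted one, which puts it into the regular part.
  For a factorization of length one the claim is vacuous, although the factor itself may be a
  zero divisor.\<close>

lemma other_factors_regular:
  assumes "factorization (reg_part \<tau>) a u xs" and "j < length xs"
  shows "set (omit j xs) \<subseteq> regular_elements"
proof
  fix y assume "y \<in> set (omit j xs)"
  then obtain k where "k < length xs" "k \<noteq> j" "y = xs ! k"
    using assms(2) by (rule in_set_omitE)
  with assms have "(y, xs ! j) \<in> reg_part \<tau>"
    by (auto simp: factorization_def)
  then show "y \<in> regular_elements"
    by (simp add: reg_part_def)
qed

lemma factor_essential: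
  assumes "factorization (reg_part \<tau>) a u xs" and "j < length xs"
  shows "essential_at xs j"
proof -
  have "xs ! j \<notin> ring_units"
    using assms by (simp add: factorization_def)
  then show ?thesis
    unfolding essential_at_def
    using regular_prod_list[OF other_factors_regular[OF assms]] by (rule not_absorbed_by_regular)
qed

lemma no_inessential_divisors:
  assumes U: "U_factorization a u xs bs" and fact: "factorization (reg_part \<tau>) a u (xs @ bs)"
  shows "xs = []"
proof (rule ccontr)
  assume "xs \<noteq> []"
  then obtain x ys where xs: "xs = x # ys"
    by (cases xs) auto
  have "set (omit 0 (xs @ bs)) \<subseteq> regular_elements"
    using fact by (rule other_factors_regular) (simp add: xs)
  then have "prod_list bs \<in> regular_elements"
    by (intro regular_prod_list) (simp add: xs omit_def)
  moreover have "x \<notin> ring_units"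
    and "ideal_mult x (principal_ideal (prod_list bs)) = principal_ideal (prod_list bs)"
    using U by (auto simp: U_factorization_def xs)
  ultimately show False
    by (metis not_absorbed_by_regular)
qed

theorem lemma5p4:
  fixes \<tau> :: "('a::comm_ring_1 \<times> 'a) set" and \<alpha> :: atomicity
  assumes "\<tau> \<subseteq> nonzero_nonunits \<times> nonzero_nonunits" and "sym \<tau>"
  shows "(\<forall>a u xs bs. U_alpha_factorization \<alpha> (reg_part \<tau>) a u xs bs \<longrightarrow> xs = []) \<and>
    (\<forall>a u xs. alpha_factorization \<alpha> (reg_part \<tau>) a u xs \<longrightarrow>
      (\<forall>j<length xs.
        ideal_mult (xs ! j) (principal_ideal (prod_list (omit j xs)))
          \<noteq> principal_ideal (prod_list (omit j xs))))"
proof (intro conjI allI impI)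
  fix a u :: 'a and xs bs :: "'a list"
  assume "U_alpha_factorization \<alpha> (reg_part \<tau>) a u xs bs"
  then have "U_factorization a u xs bs" and "factorization (reg_part \<tau>) a u (xs @ bs)"
    by (simp_all add: U_alpha_factorization_def)
  then show "xs = []"
    by (rule no_inessential_divisors)
next
  fix a u :: 'a and xs :: "'a list" and j
  assume "alpha_factorization \<alpha> (reg_part \<tau>) a u xs" and "j < length xs"
  then have "essential_at xs j"
    unfolding alpha_factorization_def by (blast intro: factor_essential)
  then show "ideal_mult (xs ! j) (principal_ideal (prod_list (omit j xs)))
      \<noteq> principal_ideal (prod_list (omit j xs))"
    by (simp add: essential_at_def)
qed

end
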